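(* In a Gaussian graphical model with underlying graph the complete bipartite graph $K_{2,m}$, the ML degree is $2m+1$.
   Context: $K_{2,m}$ is the complete bipartite graph on the vertex set $\{1,\dots,m+2\}$ with parts $\{1,2\}$ and $\{3,\dots,m+2\}$. For an undirected graph $G=([p],E)$, where $E$ is taken to contain all self-loops $(i,i)$, the (mean zero) Gaussian graphical model on $G$ is the family of distributions $\mathcal{N}(0,\Sigma)$ on $\mathbb{R}^p$ with $\Sigma$ positive definite and $(\Sigma^{-1})_{ij}=0$ for all $(i,j)\notin E$. Its ML degree (the degree of the algebraic function taking a sample covariance matrix $S$ to the maximum likelihood estimate $\hat\Sigma$) is the number of complex symmetric invertible $p\times p$ matrices $\Sigma$ satisfying $\Sigma_{ij}=S_{ij}$ for all $(i,j)\in E$ (diagonal entries included) and $(\Sigma^{-1})_{ij}=0$ for all $(i,j)\notin E$, where $S$ is a generic symmetric $p\times p$ matrix.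
   Formalization: The case m = 1 is excluded, because K_{2,1} is a path (decomposable), where the only condition is Σ_12 S_33 = S_13 S_23, so the ML degree is 1 and not 2m+1 = 3. *)

theory Defs
  imports "HOL-Computational_Algebra.Polynomial" "Jordan_Normal_Form.Matrix"
begin

text \<open>Vertices and matrix indices are \<open>0, \<dots>, p - 1\<close>: vertex \<open>v\<close> of the graph on \<open>{1, \<dots>, p}\<close>
  is written \<open>v - 1\<close>, in line with the indexing of \<^typ>\<open>'a mat\<close>.\<close>

definition complete_bipartite :: "'v set \<Rightarrow> 'v set \<Rightarrow> ('v \<times> 'v) set" where
  "complete_bipartite A B = A \<times> B \<union> B \<times> A"

text \<open>The edge set of a graph on \<open>p\<close> vertices in the convention of Gaussian graphical models:
  every vertex carries a self-loop.\<close>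

definition with_loops :: "nat \<Rightarrow> (nat \<times> nat) set \<Rightarrow> (nat \<times> nat) set" where
  "with_loops p E = E \<union> {(i, i) | i. i < p}"

definition K2_edges :: "nat \<Rightarrow> (nat \<times> nat) set" where
  "K2_edges m = with_loops (m + 2) (complete_bipartite {0, 1} {2..<m + 2})"

definition sym_mats :: "nat \<Rightarrow> complex mat set" where
  "sym_mats p = {A \<in> carrier_mat p p. transpose_mat A = A}"

definition ml_solutions :: "nat \<Rightarrow> (nat \<times> nat) set \<Rightarrow> complex mat \<Rightarrow> complex mat set" where
  "ml_solutions p E S = {\<Sigma> \<in> sym_mats p.
     (\<forall>i<p. \<forall>j<p. (i, j) \<in> E \<longrightarrow> \<Sigma> $$ (i, j) = S $$ (i, j)) \<and>
     (\<exists>K \<in> carrier_mat p p. inverts_mat \<Sigma> K \<and> inverts_mat K \<Sigma> \<and>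
        (\<forall>i<p. \<forall>j<p. (i, j) \<notin> E \<longrightarrow> K $$ (i, j) = 0))}"

inductive_set mat_poly_funs :: "nat \<Rightarrow> (complex mat \<Rightarrow> complex) set" for p where
  const: "(\<lambda>_. c) \<in> mat_poly_funs p"
| entry: "i < p \<Longrightarrow> j < p \<Longrightarrow> (\<lambda>S. S $$ (i, j)) \<in> mat_poly_funs p"
| add: "f \<in> mat_poly_funs p \<Longrightarrow> g \<in> mat_poly_funs p \<Longrightarrow> (\<lambda>S. f S + g S) \<in> mat_poly_funs p"
| mult: "f \<in> mat_poly_funs p \<Longrightarrow> g \<in> mat_poly_funs p \<Longrightarrow> (\<lambda>S. f S * g S) \<in> mat_poly_funs p"

text \<open>A property holds for a generic symmetric matrix if it holds on a nonempty basic Zariski open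
  subset of the space of symmetric matrices. The polynomial is required to be nonzero on that
  space, not merely as a polynomial in all \<open>p\<^sup>2\<close> entries.\<close>

definition generic_sym :: "nat \<Rightarrow> (complex mat \<Rightarrow> bool) \<Rightarrow> bool" where
  "generic_sym p P \<longleftrightarrow> (\<exists>f \<in> mat_poly_funs p.
     (\<exists>S \<in> sym_mats p. f S \<noteq> 0) \<and> (\<forall>S \<in> sym_mats p. f S \<noteq> 0 \<longrightarrow> P S))"

text \<open>A relation rather than a function, so that it asserts that a generic number of solutions
  exists; uniqueness is \<open>has_ML_degree_unique\<close> below.\<close>

definition has_ML_degree :: "nat \<Rightarrow> (nat \<times> nat) set \<Rightarrow> nat \<Rightarrow> bool" where
  "has_ML_degree p E d \<longleftrightarrow>
     generic_sym p (\<lambda>S. finite (ml_solutions p E S) \<and> card (ml_solutions p E S) = d)"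

lemma mat_poly_funs_on_line:
  assumes "f \<in> mat_poly_funs p"
    and L: "\<And>i j t. i < p \<Longrightarrow> j < p \<Longrightarrow> L t $$ (i, j) = A $$ (i, j) + t * (B $$ (i, j) - A $$ (i, j))"
  shows "\<exists>P. \<forall>t. f (L t) = poly P t"
  using assms(1)
proof induction
  case (const c)
  show ?case by (intro exI[of _ "[:c:]"]) simp
next
  case (entry i j)
  then show ?case
    by (intro exI[of _ "[:A $$ (i, j), B $$ (i, j) - A $$ (i, j):]"]) (simp add: L)
next
  case (add f g)
  then show ?case by (metis poly_add)
next
  case (mult f g)
  then show ?case by (metis poly_mult)
qed

lemma generic_sym_conj:
  assumes "generic_sym p P" "generic_sym p Q"
  shows "\<exists>S \<in> sym_mats p. P S \<and> Q S"
proof -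
  obtain f A where f: "f \<in> mat_poly_funs p" "A \<in> sym_mats p" "f A \<noteq> 0"
    "\<And>S. S \<in> sym_mats p \<Longrightarrow> f S \<noteq> 0 \<Longrightarrow> P S"
    using assms(1) unfolding generic_sym_def by blast
  obtain g B where g: "g \<in> mat_poly_funs p" "B \<in> sym_mats p" "g B \<noteq> 0"
    "\<And>S. S \<in> sym_mats p \<Longrightarrow> g S \<noteq> 0 \<Longrightarrow> Q S"
    using assms(2) unfolding generic_sym_def by blast
  define L where "L t = mat p p (\<lambda>(i, j). A $$ (i, j) + t * (B $$ (i, j) - A $$ (i, j)))" for t
  have L_entry: "L t $$ (i, j) = A $$ (i, j) + t * (B $$ (i, j) - A $$ (i, j))"
    if "i < p" "j < p" for i j t
    using that by (simp add: L_def)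
  obtain F G where FG: "\<And>t. f (L t) = poly F t" "\<And>t. g (L t) = poly G t"
    using mat_poly_funs_on_line[OF f(1) L_entry] mat_poly_funs_on_line[OF g(1) L_entry] by blast
  have AB: "A \<in> carrier_mat p p" "A\<^sup>T = A" "B \<in> carrier_mat p p" "B\<^sup>T = B"
    using f(2) g(2) by (auto simp: sym_mats_def)
  have sym: "A $$ (j, i) = A $$ (i, j)" "B $$ (j, i) = B $$ (i, j)" if "i < p" "j < p" for i j
    using AB that by (metis carrier_matD index_transpose_mat(1))+
  have L: "L t \<in> sym_mats p" for t
    unfolding sym_mats_def L_def by (auto intro!: eq_matI simp: sym)
  have "L 0 = A" "L 1 = B"
    using AB by (auto intro!: eq_matI simp: L_def)
  then have "F \<noteq> 0" "G \<noteq> 0"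
    using f(3) g(3) FG(1)[of 0] FG(2)[of 1] by auto
  then have "finite {t. poly (F * G) t = 0}"
    by (intro poly_roots_finite) simp
  then obtain t where "poly (F * G) t \<noteq> 0"
    using infinite_UNIV_char_0[where ?'a = complex] by (metis (mono_tags) ex_new_if_finite mem_Collect_eq)
  then show ?thesis
    using L[of t] f(4)[of "L t"] g(4)[of "L t"] FG[of t] by auto
qed

lemma has_ML_degree_unique:
  assumes "has_ML_degree p E d" "has_ML_degree p E d'"
  shows "d = d'"
  using generic_sym_conj[OF assms[unfolded has_ML_degree_def]] by auto

end

theory Submission
  imports Defs
    "HOL-Computational_Algebra.Fundamental_Theorem_Algebra"
    "HOL-Computational_Algebra.Field_as_Ring"
    "Subresultants.Subresultant_Gcd"
begin

text \<open>A solution \<open>\<Sigma>\<close> is determined by its entry \<open>x\<close> between the two vertices of the small part: as the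
  concentration matrix is diagonal on the large part, so is the Schur complement in \<open>\<Sigma>\<close> of the
  leading \<open>2 \<times> 2\<close> block \<open>X\<close>, which fixes all other free entries. Let \<open>q k\<close> (below \<open>minor_poly\<close>) be the
  principal \<open>3 \<times> 3\<close> minor on the small part and the \<open>k\<close>-th vertex of the large one, and \<open>(\<alpha> k, \<beta> k)\<close>
  (\<open>cof0_poly\<close>, \<open>cof1_poly\<close>) the adjugate of \<open>X\<close> applied to the covariances of that vertex. The remaining
  condition, that the off-diagonal entry of the leading block of the concentration matrix vanishes,
  reads \<open>x = (\<Sum>k. \<alpha> k * \<beta> k / q k)\<close>. Clearing denominators gives a polynomial of degree \<open>2 * m + 1\<close>
  that is generically squarefree and has no root with some \<open>q k = 0\<close>. Where \<open>det X = 0\<close> one has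
  \<open>\<alpha> k * \<beta> k = x * q k\<close>, so the equation degenerates to \<open>x = m * x\<close>, impossible for \<open>m \<noteq> 1\<close>
  since \<open>x \<noteq> 0\<close>.\<close>

section \<open>Generic symmetric matrices\<close>

lemma mat_poly_funs_uminus:
  assumes "f \<in> mat_poly_funs p"
  shows "(\<lambda>S. - f S) \<in> mat_poly_funs p"
  using mat_poly_funs.mult[OF mat_poly_funs.const[of "-1"] assms] by simp

lemma mat_poly_funs_diff:
  assumes "f \<in> mat_poly_funs p" "g \<in> mat_poly_funs p"
  shows "(\<lambda>S. f S - g S) \<in> mat_poly_funs p"
  using mat_poly_funs.add[OF assms(1) mat_poly_funs_uminus[OF assms(2)]] by simp

lemma mat_poly_funs_sum:
  assumes "\<And>i. i \<in> I \<Longrightarrow> f i \<in> mat_poly_funs p"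
  shows "(\<lambda>S. \<Sum>i\<in>I. f i S) \<in> mat_poly_funs p"
  using assms
  by (induction I rule: infinite_finite_induct) (auto intro: mat_poly_funs.const mat_poly_funs.add)

lemma mat_poly_funs_prod:
  assumes "\<And>i. i \<in> I \<Longrightarrow> f i \<in> mat_poly_funs p"
  shows "(\<lambda>S. \<Prod>i\<in>I. f i S) \<in> mat_poly_funs p"
  using assms
  by (induction I rule: infinite_finite_induct) (auto intro: mat_poly_funs.const mat_poly_funs.mult)

lemma mat_poly_funs_power:
  assumes "f \<in> mat_poly_funs p"
  shows "(\<lambda>S. f S ^ n) \<in> mat_poly_funs p"
  using mat_poly_funs_prod[of "{..<n}" "\<lambda>_. f"] assms by simp

lemma mat_poly_funs_If:
  assumes "f \<in> mat_poly_funs p" "g \<in> mat_poly_funs p"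
  shows "(\<lambda>S. if c then f S else g S) \<in> mat_poly_funs p"
  using assms by (cases c) auto

lemmas mat_poly_funs_intros =
  mat_poly_funs.intros mat_poly_funs_uminus mat_poly_funs_diff mat_poly_funs_sum
  mat_poly_funs_prod mat_poly_funs_power mat_poly_funs_If

section \<open>Univariate polynomials varying polynomially with the matrix\<close>

definition mat_poly_family :: "nat \<Rightarrow> (complex mat \<Rightarrow> complex poly) \<Rightarrow> bool" where
  "mat_poly_family p Q \<longleftrightarrow> (\<forall>k. (\<lambda>S. coeff (Q S) k) \<in> mat_poly_funs p)"

lemma mat_poly_family_const: "mat_poly_family p (\<lambda>_. c)"
  by (simp add: mat_poly_family_def mat_poly_funs.const)

lemma mat_poly_family_pCons:
  assumes "f \<in> mat_poly_funs p" "mat_poly_family p Q"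
  shows "mat_poly_family p (\<lambda>S. pCons (f S) (Q S))"
  unfolding mat_poly_family_def
proof
  fix k show "(\<lambda>S. coeff (pCons (f S) (Q S)) k) \<in> mat_poly_funs p"
    using assms by (cases k) (auto simp: mat_poly_family_def)
qed

lemma mat_poly_family_diff:
  assumes "mat_poly_family p P" "mat_poly_family p Q"
  shows "mat_poly_family p (\<lambda>S. P S - Q S)"
  using assms by (auto simp: mat_poly_family_def intro: mat_poly_funs_diff)

lemma mat_poly_family_mult:
  assumes "mat_poly_family p P" "mat_poly_family p Q"
  shows "mat_poly_family p (\<lambda>S. P S * Q S)"
  using assms by (auto simp: mat_poly_family_def coeff_mult intro!: mat_poly_funs_sum mat_poly_funs.mult)

lemma mat_poly_family_sum:
  assumes "\<And>i. i \<in> I \<Longrightarrow> mat_poly_family p (Q i)"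
  shows "mat_poly_family p (\<lambda>S. \<Sum>i\<in>I. Q i S)"
  using assms by (auto simp: mat_poly_family_def coeff_sum intro!: mat_poly_funs_sum)

lemma mat_poly_family_prod:
  assumes "\<And>i. i \<in> I \<Longrightarrow> mat_poly_family p (Q i)"
  shows "mat_poly_family p (\<lambda>S. \<Prod>i\<in>I. Q i S)"
  using assms
  by (induction I rule: infinite_finite_induct) (auto intro: mat_poly_family_const mat_poly_family_mult)

lemma mat_poly_family_pderiv:
  assumes "mat_poly_family p Q"
  shows "mat_poly_family p (\<lambda>S. pderiv (Q S))"
  using assms unfolding mat_poly_family_def coeff_pderiv by (auto intro!: mat_poly_funs_intros)

lemmas mat_poly_family_intros =
  mat_poly_family_const mat_poly_family_pCons mat_poly_family_diff mat_poly_family_mult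
  mat_poly_family_sum mat_poly_family_prod mat_poly_family_pderiv

section \<open>Determinants and resultants\<close>

lemma mat_poly_funs_det:
  assumes "\<And>S. M S \<in> carrier_mat n n"
    and "\<And>i j. i < n \<Longrightarrow> j < n \<Longrightarrow> (\<lambda>S. M S $$ (i, j)) \<in> mat_poly_funs p"
  shows "(\<lambda>S. det (M S)) \<in> mat_poly_funs p"
  unfolding det_def'[OF assms(1)]
  by (intro mat_poly_funs_intros assms(2)) (auto simp: permutes_in_image)

text \<open>The sizes \<open>k\<close> and \<open>l\<close> do not depend on \<open>S\<close>: the
  degrees of \<open>P S\<close> and \<open>Q S\<close> may drop as \<open>S\<close> varies, but each
  entry of a Sylvester matrix of fixed size is a fixed coefficient or zero.\<close>

lemma mat_poly_funs_resultant_sub: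
  assumes "mat_poly_family p P" "mat_poly_family p Q"
  shows "(\<lambda>S. resultant_sub k l (P S) (Q S)) \<in> mat_poly_funs p"
  unfolding resultant_sub_def
proof (rule mat_poly_funs_det)
  show "sylvester_mat_sub k l (P S) (Q S) \<in> carrier_mat (k + l) (k + l)" for S
    by (rule sylvester_mat_sub_carrier)
  show "(\<lambda>S. sylvester_mat_sub k l (P S) (Q S) $$ (i, j)) \<in> mat_poly_funs p"
    if "i < k + l" "j < k + l" for i j
    using assms unfolding sylvester_mat_sub_index[OF that] mat_poly_family_def
    by (intro mat_poly_funs_intros) auto
qed

text \<open>When \<open>k\<close> and \<open>l\<close> are the true degrees this is the usual
  resultant, which vanishes exactly when the gcd is nonconstant; over the complex numbers a
  nonconstant gcd has a root.\<close>

lemma resultant_sub_eq_0_iff: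
  fixes P Q :: "complex poly"
  assumes "degree P = k" "degree Q = l" "P \<noteq> 0"
  shows "resultant_sub k l P Q = 0 \<longleftrightarrow> (\<exists>x. poly P x = 0 \<and> poly Q x = 0)"
proof -
  have "resultant_sub k l P Q = 0 \<longleftrightarrow> degree (gcd P Q) \<noteq> 0"
    using resultant_0_gcd[of P Q] assms
    by (simp add: resultant_sub_def Resultant_Prelim.resultant_def sylvester_mat_def)
  also have "\<dots> \<longleftrightarrow> (\<exists>x. poly (gcd P Q) x = 0)"
  proof
    assume "degree (gcd P Q) \<noteq> 0"
    then show "\<exists>x. poly (gcd P Q) x = 0"
      using fundamental_theorem_of_algebra[of "gcd P Q"] by (simp add: constant_degree)
  next
    assume "\<exists>x. poly (gcd P Q) x = 0"
    then show "degree (gcd P Q) \<noteq> 0"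
      using assms(3) by (metis degree_0 degree_eq_zeroE gcd_eq_0_iff pCons_0_0 poly_const_conv)
  qed
  also have "\<dots> \<longleftrightarrow> (\<exists>x. poly P x = 0 \<and> poly Q x = 0)"
    by (simp add: poly_eq_0_iff_dvd)
  finally show ?thesis .
qed

section \<open>Calculus of generic properties\<close>

lemma generic_symI:
  assumes "f \<in> mat_poly_funs p" "S \<in> sym_mats p" "f S \<noteq> 0"
  shows "generic_sym p (\<lambda>S. f S \<noteq> 0)"
  using assms unfolding generic_sym_def by blast

lemma generic_sym_mono:
  assumes "generic_sym p P" "\<And>S. S \<in> sym_mats p \<Longrightarrow> P S \<Longrightarrow> Q S"
  shows "generic_sym p Q"
  using assms unfolding generic_sym_def by blast

text \<open>The product of the two defining polynomials is a witness.
  \<open>generic_sym_conj\<close> supplies a symmetric matrix where both factors are nonzero: two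
  nonempty basic open sets always meet.\<close>

lemma generic_sym_conjI:
  assumes "generic_sym p P" "generic_sym p Q"
  shows "generic_sym p (\<lambda>S. P S \<and> Q S)"
proof -
  obtain f where f: "f \<in> mat_poly_funs p" "generic_sym p (\<lambda>S. f S \<noteq> 0)"
    "\<And>S. S \<in> sym_mats p \<Longrightarrow> f S \<noteq> 0 \<Longrightarrow> P S"
    using assms(1) unfolding generic_sym_def by blast
  obtain g where g: "g \<in> mat_poly_funs p" "generic_sym p (\<lambda>S. g S \<noteq> 0)"
    "\<And>S. S \<in> sym_mats p \<Longrightarrow> g S \<noteq> 0 \<Longrightarrow> Q S"
    using assms(2) unfolding generic_sym_def by blast
  obtain S where "S \<in> sym_mats p" "f S \<noteq> 0" "g S \<noteq> 0"
    using generic_sym_conj[OF f(2) g(2)] by blast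
  then have "generic_sym p (\<lambda>S. f S * g S \<noteq> 0)"
    by (intro generic_symI[OF mat_poly_funs.mult[OF f(1) g(1)]]) auto
  then show ?thesis
    by (rule generic_sym_mono) (use f(3) g(3) in auto)
qed

lemma generic_sym_all_less:
  fixes n :: nat
  assumes "\<And>i. i < n \<Longrightarrow> generic_sym p (P i)"
  shows "generic_sym p (\<lambda>S. \<forall>i<n. P i S)"
  using assms
proof (induction n)
  case 0
  \<comment> \<open>The empty conjunction is witnessed by the constant 1; the zero matrix only shows
    that symmetric matrices exist.\<close>
  have "generic_sym p (\<lambda>S. (1::complex) \<noteq> 0)"
    by (rule generic_symI[OF mat_poly_funs.const, of "0\<^sub>m p p"]) (auto simp: sym_mats_def)
  then show ?case by simp
next
  case (Suc n)
  have "generic_sym p (\<lambda>S. (\<forall>i<n. P i S) \<and> P n S)"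
    using Suc by (intro generic_sym_conjI) auto
  then show ?case by (rule generic_sym_mono) (auto simp: less_Suc_eq)
qed

section \<open>Indices and blocks: 0 and 1 are the small part, \<open>Suc (Suc k)\<close> is the
  \<open>k\<close>-th vertex of the large part\<close>

lemma less_add_2_cases:
  assumes "i < m + 2"
  obtains "i = 0" | "i = 1" | k where "k < m" "i = Suc (Suc k)"
  using assms by (metis One_nat_def Suc_less_eq add_2_eq_Suc' not0_implies_Suc)

lemma sum_lessThan_add_2:
  "(\<Sum>k<m + 2. f k) = f 0 + f (Suc 0) + (\<Sum>k<m. f (Suc (Suc k)))"
  for f :: "nat \<Rightarrow> 'a :: comm_monoid_add"
  by (simp add: sum.lessThan_Suc_shift add.assoc del: sum.lessThan_Suc)

lemma mat_mult_entry:
  assumes "A \<in> carrier_mat n n" "B \<in> carrier_mat n n" "i < n" "j < n"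
  shows "(A * B) $$ (i, j) = (\<Sum>k<n. A $$ (i, k) * B $$ (k, j))"
  using assms by (simp add: scalar_prod_def atLeast0LessThan)

lemma K2_edges_iff:
  "i < m + 2 \<Longrightarrow> j < m + 2 \<Longrightarrow>
   (i, j) \<in> K2_edges m \<longleftrightarrow> i = j \<or> i < 2 \<and> 2 \<le> j \<or> 2 \<le> i \<and> j < 2"
  by (auto simp: K2_edges_def with_loops_def complete_bipartite_def)

lemma sym_mats_entry:
  assumes "A \<in> sym_mats p" "i < p" "j < p"
  shows "A $$ (j, i) = A $$ (i, j)"
  using assms unfolding sym_mats_def by (metis (mono_tags) carrier_matD index_transpose_mat(1) mem_Collect_eq)

section \<open>The score polynomial\<close>

text \<open>There are no assumptions on \<open>S\<close>, so the constants below are exported as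
  total functions of the matrix. This form is what the genericity argument needs.\<close>

locale K2_sample =
  fixes S :: "complex mat"
begin

definition "a = S $$ (0, 0)"
definition "b = S $$ (1, 1)"
definition "u k = S $$ (0, k + 2)"
definition "v k = S $$ (1, k + 2)"
definition "z k = S $$ (k + 2, k + 2)"

definition minor_poly :: "nat \<Rightarrow> complex poly" where
  "minor_poly k = [: a * b * z k - b * (u k)\<^sup>2 - a * (v k)\<^sup>2, 2 * u k * v k, - z k :]"

definition cof0_poly :: "nat \<Rightarrow> complex poly" where
  "cof0_poly k = [: b * u k, - v k :]"

definition cof1_poly :: "nat \<Rightarrow> complex poly" where
  "cof1_poly k = [: a * v k, - u k :]"

definition score :: "nat \<Rightarrow> complex poly" where
  "score m = pCons 0 (\<Prod>k<m. minor_poly k)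
     - (\<Sum>k<m. cof0_poly k * cof1_poly k * (\<Prod>j\<in>{..<m} - {k}. minor_poly j))"

text \<open>The inequality between \<open>a * (v k)\<^sup>2\<close> and
  \<open>b * (u k)\<^sup>2\<close> keeps both cofactors nonzero where \<open>det X = 0\<close>; the
  next two prevent a minor and a cofactor from vanishing together where \<open>det X\<close> is
  nonzero. The resultants separate the roots of different minors and, as a discriminant, make the
  score squarefree.\<close>

definition nondegenerate :: "nat \<Rightarrow> bool" where
  "nondegenerate m \<longleftrightarrow> a \<noteq> 0 \<and> b \<noteq> 0 \<and>
     (\<forall>k<m. z k \<noteq> 0 \<and> a * (v k)\<^sup>2 \<noteq> b * (u k)\<^sup>2 \<and> z k * b \<noteq> (v k)\<^sup>2 \<and> z k * a \<noteq> (u k)\<^sup>2) \<and>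
     (\<forall>i<m. \<forall>j<m. i \<noteq> j \<longrightarrow> resultant_sub 2 2 (minor_poly i) (minor_poly j) \<noteq> 0) \<and>
     resultant_sub (2 * m + 1) (2 * m) (score m) (pderiv (score m)) \<noteq> 0"

lemma degree_minor_poly: "z k \<noteq> 0 \<Longrightarrow> degree (minor_poly k) = 2"
  by (simp add: minor_poly_def)

text \<open>The first product has degree \<open>2 * m + 1\<close>, while each subtracted term has
  degree at most \<open>2 + 2 * (m - 1)\<close>, so nothing cancels at the top.\<close>

lemma degree_score:
  assumes "\<And>k. k < m \<Longrightarrow> z k \<noteq> 0"
  shows "degree (score m) = 2 * m + 1"
proof -
  have nz: "minor_poly k \<noteq> 0" if "k < m" for k
    using degree_minor_poly[OF assms[OF that]] by auto
  have "degree (cof0_poly k * cof1_poly k * (\<Prod>j\<in>{..<m} - {k}. minor_poly j)) < 2 * m + 1"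
    if "k < m" for k
  proof -
    have "degree (cof0_poly k) \<le> 1" "degree (cof1_poly k) \<le> 1"
      by (auto simp: cof0_poly_def cof1_poly_def)
    then have "degree (cof0_poly k * cof1_poly k) \<le> 2"
      using degree_mult_le[of "cof0_poly k" "cof1_poly k"] by linarith
    moreover have "degree (\<Prod>j\<in>{..<m} - {k}. minor_poly j) = 2 * (m - 1)"
      using assms that by (subst degree_prod_sum_eq) (auto simp: nz degree_minor_poly)
    ultimately show ?thesis
      using degree_mult_le[of "cof0_poly k * cof1_poly k" "\<Prod>j\<in>{..<m} - {k}. minor_poly j"] that
      by linarith
  qed
  then have less: "degree (\<Sum>k<m. cof0_poly k * cof1_poly k * (\<Prod>j\<in>{..<m} - {k}. minor_poly j)) < 2 * m + 1"
    by (intro degree_sum_less) auto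
  have "degree (\<Prod>k<m. minor_poly k) = 2 * m"
    using assms by (subst degree_prod_sum_eq) (auto simp: nz degree_minor_poly)
  moreover have "(\<Prod>k<m. minor_poly k) \<noteq> 0"
    using nz by auto
  ultimately have "degree (pCons 0 (\<Prod>k<m. minor_poly k)) = 2 * m + 1"
    by simp
  then show ?thesis
    using less unfolding score_def diff_conv_add_uminus
    by (subst degree_add_eq_left) simp_all
qed

text \<open>Expansion of the bordered determinant along its last row: \<open>q k / det X\<close> is
  the Schur complement of \<open>X\<close> in the principal submatrix on the small part and the
  \<open>k\<close>-th large vertex.\<close>

lemma poly_minor_poly:
  "poly (minor_poly k) x =
     (a * b - x\<^sup>2) * z k - poly (cof0_poly k) x * u k - poly (cof1_poly k) x * v k"
  by (simp add: minor_poly_def cof0_poly_def cof1_poly_def algebra_simps power2_eq_square)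

text \<open>Jacobi's identity for a \<open>2 \<times> 2\<close> minor of the adjugate of the
  \<open>3 \<times> 3\<close> submatrix. Where \<open>det X = 0\<close> it leaves
  \<open>x * q k\<close>.\<close>

lemma poly_cof0_cof1:
  "poly (cof0_poly k) x * poly (cof1_poly k) x =
     x * poly (minor_poly k) x + (a * b - x\<^sup>2) * (u k * v k - z k * x)"
  by (simp add: minor_poly_def cof0_poly_def cof1_poly_def algebra_simps power2_eq_square)

lemma poly_score_factor:
  assumes "\<And>k. k < m \<Longrightarrow> poly (minor_poly k) x \<noteq> 0"
  shows "poly (score m) x = (\<Prod>k<m. poly (minor_poly k) x) *
    (x - (\<Sum>k<m. poly (cof0_poly k) x * poly (cof1_poly k) x / poly (minor_poly k) x))"
proof -
  have "(\<Prod>j\<in>{..<m} - {k}. poly (minor_poly j) x) =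
      (\<Prod>j<m. poly (minor_poly j) x) / poly (minor_poly k) x" if "k < m" for k
    using assms that by (simp add: prod_diff1)
  then show ?thesis
    by (simp add: score_def poly_sum poly_prod sum_distrib_left algebra_simps)
qed

section \<open>Roots of the score of a nondegenerate sample\<close>

context
  fixes m :: nat and x :: complex
  assumes nondeg: "nondegenerate m" and root: "poly (score m) x = 0"
begin

lemma nondegenerateD:
  "a \<noteq> 0" "b \<noteq> 0"
  "k < m \<Longrightarrow> z k \<noteq> 0" "k < m \<Longrightarrow> a * (v k)\<^sup>2 \<noteq> b * (u k)\<^sup>2"
  "k < m \<Longrightarrow> z k * b \<noteq> (v k)\<^sup>2" "k < m \<Longrightarrow> z k * a \<noteq> (u k)\<^sup>2"
  using nondeg by (auto simp: nondegenerate_def)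

lemma minors_no_common_root:
  assumes "i < m" "j < m" "i \<noteq> j" "poly (minor_poly i) x = 0"
  shows "poly (minor_poly j) x \<noteq> 0"
proof -
  have "minor_poly i \<noteq> 0"
    using nondegenerateD(3)[OF assms(1)] by (auto simp: minor_poly_def)
  then show ?thesis
    using nondeg assms resultant_sub_eq_0_iff[of "minor_poly i" 2 "minor_poly j" 2]
    by (auto simp: nondegenerate_def degree_minor_poly)
qed

text \<open>If a minor and one of its cofactors vanish together, Jacobi's identity for a principal
  minor of the adjugate forces \<open>a * b - x\<^sup>2 = 0\<close>; a second identity then
  contradicts that \<open>a * (v k)\<^sup>2\<close> and \<open>b * (u k)\<^sup>2\<close>
  differ.\<close>

lemma minor_root_imp_cof:
  assumes "k < m" "poly (minor_poly k) x = 0"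
  shows "poly (cof0_poly k) x \<noteq> 0" "poly (cof1_poly k) x \<noteq> 0"
proof -
  show "poly (cof0_poly k) x \<noteq> 0"
  proof
    assume cof: "poly (cof0_poly k) x = 0"
    have "(a * b - x\<^sup>2) * (z k * b - (v k)\<^sup>2) =
        b * poly (minor_poly k) x + (poly (cof0_poly k) x)\<^sup>2"
      by (simp add: minor_poly_def cof0_poly_def algebra_simps power2_eq_square)
    then have "a * b - x\<^sup>2 = 0" using assms cof nondegenerateD(5)[OF assms(1)] by simp
    moreover have "b * (a * (v k)\<^sup>2 - b * (u k)\<^sup>2) =
        (a * b - x\<^sup>2) * (v k)\<^sup>2 - poly (cof0_poly k) x * (b * u k + x * v k)"
      by (simp add: cof0_poly_def algebra_simps power2_eq_square)
    ultimately show False using cof nondegenerateD(2) nondegenerateD(4)[OF assms(1)] by simp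
  qed
  show "poly (cof1_poly k) x \<noteq> 0"
  proof
    assume cof: "poly (cof1_poly k) x = 0"
    have "(a * b - x\<^sup>2) * (z k * a - (u k)\<^sup>2) =
        a * poly (minor_poly k) x + (poly (cof1_poly k) x)\<^sup>2"
      by (simp add: minor_poly_def cof1_poly_def algebra_simps power2_eq_square)
    then have "a * b - x\<^sup>2 = 0" using assms cof nondegenerateD(6)[OF assms(1)] by simp
    moreover have "a * (a * (v k)\<^sup>2 - b * (u k)\<^sup>2) =
        poly (cof1_poly k) x * (a * v k + x * u k) - (a * b - x\<^sup>2) * (u k)\<^sup>2"
      by (simp add: cof1_poly_def algebra_simps power2_eq_square)
    ultimately show False using cof nondegenerateD(1) nondegenerateD(4)[OF assms(1)] by simp
  qed
qed

text \<open>If \<open>q k\<close> vanished at the root, every term of the score containing this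
  factor would drop out. The one left is the \<open>k\<close>-th summand, a product of nonzero
  factors.\<close>

lemma score_root_imp_minor_nonzero:
  assumes "k < m"
  shows "poly (minor_poly k) x \<noteq> 0"
proof
  assume q0: "poly (minor_poly k) x = 0"
  define t where "t i = poly (cof0_poly i) x * poly (cof1_poly i) x *
    (\<Prod>j\<in>{..<m} - {i}. poly (minor_poly j) x)" for i
  have "poly (score m) x = x * (\<Prod>j<m. poly (minor_poly j) x) - (\<Sum>i<m. t i)"
    by (simp add: score_def poly_sum poly_prod t_def)
  moreover have "(\<Prod>j<m. poly (minor_poly j) x) = 0"
    using assms q0 by auto
  ultimately have "(\<Sum>i<m. t i) = 0"
    using root by simp
  also have "(\<Sum>i<m. t i) = t k + (\<Sum>i\<in>{..<m} - {k}. t i)"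
    using assms by (subst sum.remove[of _ k]) auto
  also have "(\<Sum>i\<in>{..<m} - {k}. t i) = 0"
    using assms q0 unfolding t_def by (intro sum.neutral ballI) (auto intro!: prod_zero)
  finally show False
    using assms q0 minor_root_imp_cof[OF assms q0] minors_no_common_root[OF assms _ _ q0]
    by (auto simp: t_def)
qed

lemma score_root_imp_det_nonzero:
  assumes "m \<noteq> 1"
  shows "a * b - x\<^sup>2 \<noteq> 0"
proof
  assume d0: "a * b - x\<^sup>2 = 0"
  have "x \<noteq> 0" using d0 nondegenerateD(1,2) by auto
  have "(\<Sum>k<m. poly (cof0_poly k) x * poly (cof1_poly k) x / poly (minor_poly k) x) = (\<Sum>k<m. x)"
    by (rule sum.cong) (auto simp: poly_cof0_cof1 d0 score_root_imp_minor_nonzero)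
  then have "(\<Prod>k<m. poly (minor_poly k) x) * (x * (1 - of_nat m)) = 0"
    using root poly_score_factor[OF score_root_imp_minor_nonzero] by (simp add: algebra_simps)
  moreover have "(\<Prod>k<m. poly (minor_poly k) x) \<noteq> 0"
    using score_root_imp_minor_nonzero by simp
  moreover have "1 - of_nat m \<noteq> (0 :: complex)"
    using assms by (metis eq_iff_diff_eq_0 of_nat_1 of_nat_eq_iff)
  ultimately show False using \<open>x \<noteq> 0\<close> by simp
qed

lemma score_root_imp_sum:
  "(\<Sum>k<m. poly (cof0_poly k) x * poly (cof1_poly k) x / poly (minor_poly k) x) = x"
  using root poly_score_factor[OF score_root_imp_minor_nonzero] score_root_imp_minor_nonzero
  by simp

end

text \<open>The score shares no root with its derivative, so it splits into distinct linear factors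
  and has as many roots as its degree.\<close>

lemma card_roots_score:
  assumes "nondegenerate m"
  shows "finite {x. poly (score m) x = 0}" "card {x. poly (score m) x = 0} = 2 * m + 1"
proof -
  have deg: "degree (score m) = 2 * m + 1"
    using assms by (intro degree_score) (auto simp: nondegenerate_def)
  then have nz: "score m \<noteq> 0" by auto
  then show "finite {x. poly (score m) x = 0}" by (rule poly_roots_finite)
  have "rsquarefree (score m)"
    using assms resultant_sub_eq_0_iff[OF deg _ nz, of "pderiv (score m)" "2 * m"]
    by (auto simp: nondegenerate_def rsquarefree_roots degree_pderiv deg)
  then have "Polynomial.smult (lead_coeff (score m)) (\<Prod>x | poly (score m) x = 0. [:- x, 1:]) = score m"
    by (rule complex_poly_decompose_rsquarefree)
  then have "degree (score m) = degree (\<Prod>x | poly (score m) x = 0. [:- x, 1:])"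
    using nz by (metis degree_smult_eq leading_coeff_0_iff)
  also have "\<dots> = card {x. poly (score m) x = 0}"
    by (subst degree_prod_sum_eq) auto
  finally show "card {x. poly (score m) x = 0} = 2 * m + 1"
    using deg by simp
qed

section \<open>Solutions of the likelihood equations\<close>

text \<open>With \<open>W\<close> the small-by-large block, the large block is the transpose of
  \<open>W\<close> times the inverse of \<open>X\<close> times \<open>W\<close>, plus the diagonal
  Schur complement with entries \<open>q k / det X\<close>.\<close>

definition sol_mat :: "nat \<Rightarrow> complex \<Rightarrow> complex mat" where
  "sol_mat m x = mat (m + 2) (m + 2) (\<lambda>(i, j).
     if i < 2 \<and> j < 2 then (if i = j then S $$ (i, j) else x)
     else if i < 2 then S $$ (i, j)
     else if j < 2 then S $$ (j, i)
     else (poly (cof0_poly (i - 2)) x * u (j - 2) + poly (cof1_poly (i - 2)) x * v (j - 2)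
       + (if i = j then poly (minor_poly (i - 2)) x else 0)) / (a * b - x\<^sup>2))"

text \<open>Block inversion of \<open>sol_mat\<close>: the large block inverts the Schur complement,
  and \<open>det X\<close> cancels in the mixed block. The first two diagonal entries are solved
  from the diagonal of the product being 1, given the zero entry between the small vertices. For
  mixed indices \<open>min\<close> is the small vertex and \<open>max\<close> the large one.\<close>

definition conc_mat :: "nat \<Rightarrow> complex \<Rightarrow> complex mat" where
  "conc_mat m x = mat (m + 2) (m + 2) (\<lambda>(i, j).
     if i < 2 \<and> j < 2 then
       (if i \<noteq> j then 0
        else if i = 0 then (1 + (\<Sum>k<m. poly (cof0_poly k) x / poly (minor_poly k) x * u k)) / a
        else (1 + (\<Sum>k<m. poly (cof1_poly k) x / poly (minor_poly k) x * v k)) / b)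
     else if i \<ge> 2 \<and> j \<ge> 2 then
       (if i = j then (a * b - x\<^sup>2) / poly (minor_poly (i - 2)) x else 0)
     else if min i j = 0 then - poly (cof0_poly (max i j - 2)) x / poly (minor_poly (max i j - 2)) x
     else - poly (cof1_poly (max i j - 2)) x / poly (minor_poly (max i j - 2)) x)"

lemma sol_mat_simps:
  "sol_mat m x $$ (0, 0) = a" "sol_mat m x $$ (Suc 0, Suc 0) = b"
  "sol_mat m x $$ (0, Suc 0) = x" "sol_mat m x $$ (Suc 0, 0) = x"
  "k < m \<Longrightarrow> sol_mat m x $$ (0, Suc (Suc k)) = u k"
  "k < m \<Longrightarrow> sol_mat m x $$ (Suc 0, Suc (Suc k)) = v k"
  "k < m \<Longrightarrow> sol_mat m x $$ (Suc (Suc k), 0) = u k"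
  "k < m \<Longrightarrow> sol_mat m x $$ (Suc (Suc k), Suc 0) = v k"
  "k < m \<Longrightarrow> l < m \<Longrightarrow> sol_mat m x $$ (Suc (Suc k), Suc (Suc l)) =
     (poly (cof0_poly k) x * u l + poly (cof1_poly k) x * v l
       + (if k = l then poly (minor_poly k) x else 0)) / (a * b - x\<^sup>2)"
  by (simp_all add: sol_mat_def a_def b_def u_def v_def)

lemma conc_mat_simps:
  "conc_mat m x $$ (0, 0) = (1 + (\<Sum>k<m. poly (cof0_poly k) x / poly (minor_poly k) x * u k)) / a"
  "conc_mat m x $$ (Suc 0, Suc 0) =
     (1 + (\<Sum>k<m. poly (cof1_poly k) x / poly (minor_poly k) x * v k)) / b"
  "conc_mat m x $$ (0, Suc 0) = 0" "conc_mat m x $$ (Suc 0, 0) = 0"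
  "k < m \<Longrightarrow> conc_mat m x $$ (0, Suc (Suc k)) = - (poly (cof0_poly k) x / poly (minor_poly k) x)"
  "k < m \<Longrightarrow> conc_mat m x $$ (Suc 0, Suc (Suc k)) = - (poly (cof1_poly k) x / poly (minor_poly k) x)"
  "k < m \<Longrightarrow> conc_mat m x $$ (Suc (Suc k), 0) = - (poly (cof0_poly k) x / poly (minor_poly k) x)"
  "k < m \<Longrightarrow> conc_mat m x $$ (Suc (Suc k), Suc 0) = - (poly (cof1_poly k) x / poly (minor_poly k) x)"
  "k < m \<Longrightarrow> l < m \<Longrightarrow> conc_mat m x $$ (Suc (Suc k), Suc (Suc l)) =
     (if k = l then (a * b - x\<^sup>2) / poly (minor_poly k) x else 0)"
  by (simp_all add: conc_mat_def)

lemma sol_mat_carrier: "sol_mat m x \<in> carrier_mat (m + 2) (m + 2)"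
  and conc_mat_carrier: "conc_mat m x \<in> carrier_mat (m + 2) (m + 2)"
  by (simp_all add: sol_mat_def conc_mat_def)

lemma sol_mat_sym: "sol_mat m x \<in> sym_mats (m + 2)"
proof -
  have "sol_mat m x $$ (j, i) = sol_mat m x $$ (i, j)" if "i < m + 2" "j < m + 2" for i j
    using that
    by (elim less_add_2_cases; simp add: sol_mat_simps;
        auto simp: cof0_poly_def cof1_poly_def algebra_simps)
  then show ?thesis
    using sol_mat_carrier[of m x] by (auto simp: sym_mats_def intro!: eq_matI)
qed

lemma conc_mat_mult_sol_mat:
  assumes a: "a \<noteq> 0" and b: "b \<noteq> 0" and d: "a * b - x\<^sup>2 \<noteq> 0"
    and q: "\<And>k. k < m \<Longrightarrow> poly (minor_poly k) x \<noteq> 0"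
    and sum: "(\<Sum>k<m. poly (cof0_poly k) x * poly (cof1_poly k) x / poly (minor_poly k) x) = x"
  shows "conc_mat m x * sol_mat m x = 1\<^sub>m (m + 2)"
proof -
  define \<alpha> \<beta> q d where "\<alpha> k = poly (cof0_poly k) x" and "\<beta> k = poly (cof1_poly k) x"
    and "q k = poly (minor_poly k) x" and "d = a * b - x\<^sup>2" for k
  note defs = \<alpha>_def[symmetric] \<beta>_def[symmetric] q_def[symmetric] d_def[symmetric]
  have \<alpha>: "\<alpha> k = b * u k - x * v k" and \<beta>: "\<beta> k = a * v k - x * u k" for k
    by (simp_all add: \<alpha>_def \<beta>_def cof0_poly_def cof1_poly_def)
  have \<alpha>\<beta>: "(\<Sum>k<m. \<alpha> k / q k * \<beta> k) = x"
    using sum by (simp add: \<alpha>_def \<beta>_def q_def)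
  have \<beta>\<alpha>: "(\<Sum>k<m. \<beta> k / q k * \<alpha> k) = x"
    using \<alpha>\<beta> by (simp add: mult.commute)
  \<comment> \<open>Up to sign, these are the entries of the mixed block of \<open>conc_mat\<close>
    times the transpose of \<open>W\<close>. The hypothesis \<open>sum\<close> yields two linear
    relations, which eliminate \<open>B\<close> and \<open>A'\<close>.\<close>
  define A A' B B' where "A = (\<Sum>k<m. \<alpha> k / q k * u k)" and "A' = (\<Sum>k<m. \<beta> k / q k * u k)"
    and "B = (\<Sum>k<m. \<alpha> k / q k * v k)" and "B' = (\<Sum>k<m. \<beta> k / q k * v k)"
  have lin: "(\<Sum>k<m. g k * \<alpha> k) = b * (\<Sum>k<m. g k * u k) - x * (\<Sum>k<m. g k * v k)"
    "(\<Sum>k<m. g k * \<beta> k) = a * (\<Sum>k<m. g k * v k) - x * (\<Sum>k<m. g k * u k)" for g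
    by (simp_all add: \<alpha> \<beta> sum_distrib_left sum_subtractf algebra_simps)
  have "(\<Sum>k<m. \<alpha> k / q k * \<beta> k) = a * B - x * A" "(\<Sum>k<m. \<beta> k / q k * \<alpha> k) = b * A' - x * B'"
    unfolding A_def A'_def B_def B'_def by (rule lin)+
  then have B: "B = x * (1 + A) / a" and A': "A' = x * (1 + B') / b"
    using a b \<alpha>\<beta> \<beta>\<alpha> by (simp_all add: field_simps)
  have \<alpha>\<alpha>: "(\<Sum>k<m. \<alpha> k / q k * \<alpha> k) = b * A - x * B"
    and \<beta>\<beta>: "(\<Sum>k<m. \<beta> k / q k * \<beta> k) = a * B' - x * A'"
    unfolding A_def A'_def B_def B'_def by (rule lin)+
  \<comment> \<open>\<open>Z\<close> is the large block of \<open>sol_mat\<close>; the weights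
    \<gamma> below are instantiated with \<alpha> and \<beta>, giving the last columns of the two
    top rows.\<close>
  define Z where "Z k l = (\<alpha> k * u l + \<beta> k * v l + (if k = l then q k else 0)) / d" for k l
  have Z: "(\<Sum>k<m. \<gamma> k / q k * Z k l) =
      (u l * (\<Sum>k<m. \<gamma> k / q k * \<alpha> k) + v l * (\<Sum>k<m. \<gamma> k / q k * \<beta> k) + \<gamma> l) / d"
    if "l < m" for \<gamma> :: "nat \<Rightarrow> complex" and l
  proof -
    have "\<gamma> k / q k * Z k l =
        (u l * (\<gamma> k / q k * \<alpha> k) + v l * (\<gamma> k / q k * \<beta> k) + (if k = l then \<gamma> k else 0)) / d"
      if "k < m" for k
      using q[OF that] unfolding defs Z_def by (simp add: field_simps)
    then have "(\<Sum>k<m. \<gamma> k / q k * Z k l) = (\<Sum>k<m.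
        (u l * (\<gamma> k / q k * \<alpha> k) + v l * (\<gamma> k / q k * \<beta> k) + (if k = l then \<gamma> k else 0)) / d)"
      by simp
    also have "\<dots> = (u l * (\<Sum>k<m. \<gamma> k / q k * \<alpha> k) + v l * (\<Sum>k<m. \<gamma> k / q k * \<beta> k) + \<gamma> l) / d"
      using that by (simp add: sum_divide_distrib[symmetric] sum.distrib sum_distrib_left)
    finally show ?thesis .
  qed
  have Zsol: "sol_mat m x $$ (Suc (Suc k), Suc (Suc l)) = Z k l" if "k < m" "l < m" for k l
    using that by (simp add: sol_mat_simps Z_def defs)
  have "(\<Sum>k<m + 2. conc_mat m x $$ (i, k) * sol_mat m x $$ (k, j)) = 1\<^sub>m (m + 2) $$ (i, j)"
    if "i < m + 2" "j < m + 2" for i j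
  proof -
    note conc = conc_mat_simps[where m = m and x = x, unfolded defs]
    have K00: "conc_mat m x $$ (0, 0) = (1 + A) / a" and K11: "conc_mat m x $$ (Suc 0, Suc 0) = (1 + B') / b"
      by (simp_all add: conc A_def B'_def)
    have top:
      "(\<Sum>k<m. conc_mat m x $$ (0, Suc (Suc k)) * sol_mat m x $$ (Suc (Suc k), 0)) = - A"
      "(\<Sum>k<m. conc_mat m x $$ (0, Suc (Suc k)) * sol_mat m x $$ (Suc (Suc k), Suc 0)) = - B"
      "(\<Sum>k<m. conc_mat m x $$ (Suc 0, Suc (Suc k)) * sol_mat m x $$ (Suc (Suc k), 0)) = - A'"
      "(\<Sum>k<m. conc_mat m x $$ (Suc 0, Suc (Suc k)) * sol_mat m x $$ (Suc (Suc k), Suc 0)) = - B'"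
      by (simp_all add: conc sol_mat_simps A_def B_def A'_def B'_def sum_negf)
    have top':
      "(\<Sum>k<m. conc_mat m x $$ (0, Suc (Suc k)) * sol_mat m x $$ (Suc (Suc k), Suc (Suc l))) =
        - ((u l * (b * A - x * B) + v l * x + \<alpha> l) / d)"
      "(\<Sum>k<m. conc_mat m x $$ (Suc 0, Suc (Suc k)) * sol_mat m x $$ (Suc (Suc k), Suc (Suc l))) =
        - ((u l * x + v l * (a * B' - x * A') + \<beta> l) / d)" if "l < m" for l
      using that
      by (simp_all add: conc Zsol sum_negf Z[OF that, of \<alpha>, unfolded \<alpha>\<alpha> \<alpha>\<beta>, simplified]
          Z[OF that, of \<beta>, unfolded \<beta>\<alpha> \<beta>\<beta>, simplified])
    have bot: "(\<Sum>j<m. conc_mat m x $$ (Suc (Suc k), Suc (Suc j)) * f j) = d / q k * f k"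
      if "k < m" for k and f :: "nat \<Rightarrow> complex"
    proof -
      have "(\<Sum>j<m. conc_mat m x $$ (Suc (Suc k), Suc (Suc j)) * f j) =
          (\<Sum>j<m. if j = k then d / q k * f k else 0)"
        using that by (intro sum.cong) (auto simp: conc)
      then show ?thesis using that by simp
    qed
    have d0: "d \<noteq> 0" and q0: "\<And>k. k < m \<Longrightarrow> q k \<noteq> 0"
      using d q by (auto simp: d_def q_def)
    have row0: "(1 + A) * u l / a = (u l * (b * A - x * B) + v l * x + \<alpha> l) / d" for l
    proof -
      have "a * (u l * (b * A - x * B) + v l * x + \<alpha> l) = (1 + A) * u l * d"
        using a unfolding B \<alpha> by (simp add: field_simps d_def power2_eq_square)
      then show ?thesis using a d0 by (simp add: field_simps)
    qed
    have row1: "(1 + B') * v l / b = (u l * x + v l * (a * B' - x * A') + \<beta> l) / d" for l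
    proof -
      have "b * (u l * x + v l * (a * B' - x * A') + \<beta> l) = (1 + B') * v l * d"
        using b unfolding A' \<beta> by (simp add: field_simps d_def power2_eq_square)
      then show ?thesis using b d0 by (simp add: field_simps)
    qed
    \<comment> \<open>The large rows of the product. The first two facts say that \<open>X\<close>
      times its adjugate is \<open>det X\<close> times the identity; the third is the definition of
      \<open>Z\<close>.\<close>
    have low: "d * u k / q k = \<alpha> k * a / q k + \<beta> k * x / q k"
      "d * v k / q k = \<alpha> k * x / q k + \<beta> k * b / q k"
      "d * Z k l / q k = \<alpha> k * u l / q k + \<beta> k * v l / q k + (if k = l then 1 else 0)"
      if "k < m" for k l
    proof -
      have "d * u k = \<alpha> k * a + \<beta> k * x" "d * v k = \<alpha> k * x + \<beta> k * b"
        by (simp_all add: \<alpha> \<beta> d_def algebra_simps power2_eq_square)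
      moreover have "d * Z k l = \<alpha> k * u l + \<beta> k * v l + (if k = l then q k else 0)"
        using d0 by (simp add: Z_def)
      ultimately show "d * u k / q k = \<alpha> k * a / q k + \<beta> k * x / q k"
        "d * v k / q k = \<alpha> k * x / q k + \<beta> k * b / q k"
        "d * Z k l / q k = \<alpha> k * u l / q k + \<beta> k * v l / q k + (if k = l then 1 else 0)"
        using q0[OF that] by (auto simp: add_divide_distrib)
    qed
    have "(1 + A) * x / a = B" "(1 + B') * x / b = A'"
      by (simp_all add: B A' mult.commute)
    then show ?thesis
      unfolding sum_lessThan_add_2 using that
      by (elim less_add_2_cases; simp add: top top' bot K00 K11;
          simp add: conc(3-9) sol_mat_simps(1-8) Zsol a b q0 row0 row1 low)
  qed
  then have "(conc_mat m x * sol_mat m x) $$ (i, j) = 1\<^sub>m (m + 2) $$ (i, j)"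
    if "i < m + 2" "j < m + 2" for i j
    using mat_mult_entry[OF conc_mat_carrier sol_mat_carrier that] that by metis
  then show ?thesis
    using sol_mat_carrier[of m x] conc_mat_carrier[of m x] by (intro eq_matI) auto
qed

lemma sol_mat_in_ml_solutions:
  assumes S: "S \<in> sym_mats (m + 2)" and nondeg: "nondegenerate m" and "m \<noteq> 1"
    and root: "poly (score m) x = 0"
  shows "sol_mat m x \<in> ml_solutions (m + 2) (K2_edges m) S"
proof -
  note d = score_root_imp_det_nonzero[OF nondeg root \<open>m \<noteq> 1\<close>]
  note q = score_root_imp_minor_nonzero[OF nondeg root]
  have inv: "conc_mat m x * sol_mat m x = 1\<^sub>m (m + 2)"
    using nondegenerateD(1,2)[OF nondeg root] d q score_root_imp_sum[OF nondeg root]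
    by (rule conc_mat_mult_sol_mat)
  then have inv': "sol_mat m x * conc_mat m x = 1\<^sub>m (m + 2)"
    by (rule mat_mult_left_right_inverse[OF conc_mat_carrier sol_mat_carrier])
  have "sol_mat m x $$ (i, j) = S $$ (i, j)"
    if "i < m + 2" "j < m + 2" "(i, j) \<in> K2_edges m" for i j
  proof -
    \<comment> \<open>On the diagonal of the large block, the expansion of the minor gives back the
      prescribed variance.\<close>
    have "(poly (cof0_poly k) x * u k + poly (cof1_poly k) x * v k + poly (minor_poly k) x)
        / (a * b - x\<^sup>2) = z k" for k
      using d by (simp add: poly_minor_poly)
    then show ?thesis
      using that sym_mats_entry[OF S]
      by (elim less_add_2_cases) (auto simp: K2_edges_iff sol_mat_simps a_def b_def u_def v_def z_def)
  qed
  moreover have "conc_mat m x $$ (i, j) = 0"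
    if "i < m + 2" "j < m + 2" "(i, j) \<notin> K2_edges m" for i j
    using that by (elim less_add_2_cases) (auto simp: K2_edges_iff conc_mat_simps)
  ultimately show ?thesis
    using sol_mat_sym[of m x] conc_mat_carrier[of m x] inv inv' sol_mat_carrier[of m x]
    unfolding ml_solutions_def inverts_mat_def by auto
qed

section \<open>From a solution back to a root of the score\<close>

lemma ml_solution_entries:
  assumes S: "S \<in> sym_mats (m + 2)" and sol: "\<Sigma> \<in> ml_solutions (m + 2) (K2_edges m) S"
  shows
    "\<And>k. k < m \<Longrightarrow> \<Sigma> $$ (Suc (Suc k), Suc (Suc k)) = z k"
    "\<Sigma> $$ (0, 0) = a" "\<Sigma> $$ (Suc 0, Suc 0) = b" "\<Sigma> $$ (Suc 0, 0) = \<Sigma> $$ (0, Suc 0)"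
    "\<And>k. k < m \<Longrightarrow> \<Sigma> $$ (0, Suc (Suc k)) = u k" "\<And>k. k < m \<Longrightarrow> \<Sigma> $$ (Suc 0, Suc (Suc k)) = v k"
    "\<And>k. k < m \<Longrightarrow> \<Sigma> $$ (Suc (Suc k), 0) = u k" "\<And>k. k < m \<Longrightarrow> \<Sigma> $$ (Suc (Suc k), Suc 0) = v k"
proof -
  have \<Sigma>: "\<Sigma> \<in> sym_mats (m + 2)"
    and edge: "\<And>i j. i < m + 2 \<Longrightarrow> j < m + 2 \<Longrightarrow> (i, j) \<in> K2_edges m \<Longrightarrow> \<Sigma> $$ (i, j) = S $$ (i, j)"
    using sol by (auto simp: ml_solutions_def)
  show "\<And>k. k < m \<Longrightarrow> \<Sigma> $$ (Suc (Suc k), Suc (Suc k)) = z k"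
    "\<Sigma> $$ (0, 0) = a" "\<Sigma> $$ (Suc 0, Suc 0) = b" "\<Sigma> $$ (Suc 0, 0) = \<Sigma> $$ (0, Suc 0)"
    "\<And>k. k < m \<Longrightarrow> \<Sigma> $$ (0, Suc (Suc k)) = u k" "\<And>k. k < m \<Longrightarrow> \<Sigma> $$ (Suc 0, Suc (Suc k)) = v k"
    "\<And>k. k < m \<Longrightarrow> \<Sigma> $$ (Suc (Suc k), 0) = u k" "\<And>k. k < m \<Longrightarrow> \<Sigma> $$ (Suc (Suc k), Suc 0) = v k"
    using sym_mats_entry[OF \<Sigma>] sym_mats_entry[OF S]
    by (auto simp: edge K2_edges_iff a_def b_def u_def v_def z_def)
qed

text \<open>With \<open>K\<close> the concentration matrix, \<open>p k\<close>, \<open>r k\<close>,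
  \<open>d k\<close> are the possibly nonzero entries of its row at the \<open>k\<close>-th large
  vertex, and \<open>t\<close> is its diagonal entry at vertex 1. The first three equations come
  from \<open>K * \<Sigma> = 1\<close>, the last two from column 1 of
  \<open>\<Sigma> * K = 1\<close>.\<close>

lemma ml_solution_equations:
  assumes S: "S \<in> sym_mats (m + 2)" and sol: "\<Sigma> \<in> ml_solutions (m + 2) (K2_edges m) S"
  defines "x \<equiv> \<Sigma> $$ (0, Suc 0)"
  obtains p r d t where
    "\<And>k. k < m \<Longrightarrow> p k * a + r k * x + d k * u k = 0"
    "\<And>k. k < m \<Longrightarrow> p k * x + r k * b + d k * v k = 0"
    "\<And>k l. k < m \<Longrightarrow> l < m \<Longrightarrow>
       p k * u l + r k * v l + d k * \<Sigma> $$ (Suc (Suc k), Suc (Suc l)) = (if k = l then 1 else 0)"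
    "x * t + (\<Sum>k<m. u k * r k) = 0"
    "b * t + (\<Sum>k<m. v k * r k) = 1"
proof -
  have \<Sigma>: "\<Sigma> \<in> carrier_mat (m + 2) (m + 2)"
    using sol by (auto simp: ml_solutions_def sym_mats_def)
  obtain K where K: "K \<in> carrier_mat (m + 2) (m + 2)" "\<Sigma> * K = 1\<^sub>m (m + 2)" "K * \<Sigma> = 1\<^sub>m (m + 2)"
    and zero: "\<And>i j. i < m + 2 \<Longrightarrow> j < m + 2 \<Longrightarrow> (i, j) \<notin> K2_edges m \<Longrightarrow> K $$ (i, j) = 0"
    using sol \<Sigma> by (auto simp: ml_solutions_def inverts_mat_def)
  note entries = ml_solution_entries[OF S sol, folded x_def]
  have left: "(\<Sum>k<m + 2. K $$ (i, k) * \<Sigma> $$ (k, j)) = (if i = j then 1 else 0)"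
    and right: "(\<Sum>k<m + 2. \<Sigma> $$ (i, k) * K $$ (k, j)) = (if i = j then 1 else 0)"
    if "i < m + 2" "j < m + 2" for i j
    using that mat_mult_entry[OF K(1) \<Sigma> that] mat_mult_entry[OF \<Sigma> K(1) that]
    unfolding K(2,3) by simp_all
  have K01: "K $$ (0, Suc 0) = 0"
    by (rule zero) (auto simp: K2_edges_iff)
  have bot: "(\<Sum>l<m. K $$ (Suc (Suc k), Suc (Suc l)) * f l) = K $$ (Suc (Suc k), Suc (Suc k)) * f k"
    if "k < m" for k and f :: "nat \<Rightarrow> complex"
  proof -
    have "(\<Sum>l<m. K $$ (Suc (Suc k), Suc (Suc l)) * f l) =
        (\<Sum>l<m. if l = k then K $$ (Suc (Suc k), Suc (Suc k)) * f k else 0)"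
      using that by (intro sum.cong) (auto simp: zero K2_edges_iff)
    then show ?thesis using that by simp
  qed
  define p where "p k = K $$ (Suc (Suc k), 0)" for k
  define r where "r k = K $$ (Suc (Suc k), Suc 0)" for k
  define d where "d k = K $$ (Suc (Suc k), Suc (Suc k))" for k
  show thesis
  proof
    fix k assume k: "k < m"
    show "p k * a + r k * x + d k * u k = 0"
      using left[of "Suc (Suc k)" 0] k
      unfolding sum_lessThan_add_2 by (simp add: bot entries p_def r_def d_def)
    show "p k * x + r k * b + d k * v k = 0"
      using left[of "Suc (Suc k)" "Suc 0"] k
      unfolding sum_lessThan_add_2 by (simp add: bot entries p_def r_def d_def x_def[symmetric])
    show "p k * u l + r k * v l + d k * \<Sigma> $$ (Suc (Suc k), Suc (Suc l)) = (if k = l then 1 else 0)"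
      if "l < m" for l
      using left[of "Suc (Suc k)" "Suc (Suc l)"] k that
      unfolding sum_lessThan_add_2 by (simp add: bot entries p_def r_def d_def)
  next
    show "x * K $$ (Suc 0, Suc 0) + (\<Sum>k<m. u k * r k) = 0"
      using right[of 0 "Suc 0"]
      unfolding sum_lessThan_add_2 by (simp add: entries K01 r_def x_def[symmetric])
    show "b * K $$ (Suc 0, Suc 0) + (\<Sum>k<m. v k * r k) = 1"
      using right[of "Suc 0" "Suc 0"]
      unfolding sum_lessThan_add_2 by (simp add: entries K01 r_def)
  qed
qed

text \<open>Elimination: the large rows determine \<open>p\<close>, \<open>r\<close>,
  \<open>d\<close> and the large block from \<open>x\<close>; the two equations of column 1 then
  give the score equation.\<close>

lemma ml_solution_imp_sol_mat:
  assumes S: "S \<in> sym_mats (m + 2)" and nondeg: "nondegenerate m" and "m \<noteq> 1"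
    and sol: "\<Sigma> \<in> ml_solutions (m + 2) (K2_edges m) S"
  defines "x \<equiv> \<Sigma> $$ (0, Suc 0)"
  shows "poly (score m) x = 0" "\<Sigma> = sol_mat m x"
proof -
  obtain p r d t where
    eq: "\<And>k. k < m \<Longrightarrow> p k * a + r k * x + d k * u k = 0"
      "\<And>k. k < m \<Longrightarrow> p k * x + r k * b + d k * v k = 0"
      "\<And>k l. k < m \<Longrightarrow> l < m \<Longrightarrow>
        p k * u l + r k * v l + d k * \<Sigma> $$ (Suc (Suc k), Suc (Suc l)) = (if k = l then 1 else 0)"
    and col: "x * t + (\<Sum>k<m. u k * r k) = 0" "b * t + (\<Sum>k<m. v k * r k) = 1"
    using ml_solution_equations[OF S sol] unfolding x_def by blast
  note entries = ml_solution_entries[OF S sol, folded x_def]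
  have a: "a \<noteq> 0" and b: "b \<noteq> 0"
    and gen: "\<And>k. k < m \<Longrightarrow> a * (v k)\<^sup>2 \<noteq> b * (u k)\<^sup>2"
    using nondeg by (auto simp: nondegenerate_def)
  define \<Delta> where "\<Delta> = a * b - x\<^sup>2"
  define \<alpha> \<beta> q where "\<alpha> k = poly (cof0_poly k) x" and "\<beta> k = poly (cof1_poly k) x"
    and "q k = poly (minor_poly k) x" for k
  have \<alpha>: "\<alpha> k = b * u k - x * v k" and \<beta>: "\<beta> k = a * v k - x * u k" for k
    by (simp_all add: \<alpha>_def \<beta>_def cof0_poly_def cof1_poly_def)
  \<comment> \<open>Cramer's rule for the first two equations, with \<open>X\<close> as coefficient
    matrix and \<Delta> its determinant.\<close>
  have pk: "p k * \<Delta> = - (d k * \<alpha> k)" and rk: "r k * \<Delta> = - (d k * \<beta> k)" if "k < m" for k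
  proof -
    have "p k * \<Delta> + d k * \<alpha> k =
        b * (p k * a + r k * x + d k * u k) - x * (p k * x + r k * b + d k * v k)"
      "r k * \<Delta> + d k * \<beta> k =
        a * (p k * x + r k * b + d k * v k) - x * (p k * a + r k * x + d k * u k)"
      by (simp_all add: \<alpha> \<beta> \<Delta>_def algebra_simps power2_eq_square)
    then show "p k * \<Delta> = - (d k * \<alpha> k)" "r k * \<Delta> = - (d k * \<beta> k)"
      unfolding eq(1)[OF that] eq(2)[OF that] by (simp_all add: eq_neg_iff_add_eq_0)
  qed
  have "\<Delta> \<noteq> 0"
  proof
    assume "\<Delta> = 0"
    have \<beta>0: "\<beta> k \<noteq> 0" if "k < m" for k
    proof
      assume "\<beta> k = 0"
      moreover have "a * (a * (v k)\<^sup>2 - b * (u k)\<^sup>2) = \<beta> k * (a * v k + x * u k) - \<Delta> * (u k)\<^sup>2"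
        by (simp add: \<beta> \<Delta>_def algebra_simps power2_eq_square)
      ultimately show False using \<open>\<Delta> = 0\<close> a gen[OF that] by simp
    qed
    show False
    proof (cases "m = 0")
      case True
      then have "x = 0" using col by auto
      then show False using \<open>\<Delta> = 0\<close> a b by (simp add: \<Delta>_def)
    next
      case False
      then have m: "0 < m" "1 < m" using \<open>m \<noteq> 1\<close> by auto
      have "d 0 = 0" using rk[OF m(1)] \<open>\<Delta> = 0\<close> \<beta>0[OF m(1)] by simp
      then have pr: "p 0 * a + r 0 * x = 0" "p 0 * u 1 + r 0 * v 1 = 0" "p 0 * u 0 + r 0 * v 0 = 1"
        using eq(1)[OF m(1)] eq(3)[OF m(1) m(2)] eq(3)[OF m(1) m(1)] by simp_all
      \<comment> \<open>The row \<open>(p 0, r 0)\<close> annihilates \<open>(a, x)\<close> and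
        \<open>(u 1, v 1)\<close>, whose determinant is \<open>\<beta> 1\<close>, so it is zero,
        against its normalisation. A second large vertex is needed here.\<close>
      have "r 0 * \<beta> 1 = a * (p 0 * u 1 + r 0 * v 1) - u 1 * (p 0 * a + r 0 * x)"
        by (simp add: \<beta> algebra_simps)
      then have "r 0 * \<beta> 1 = 0" using pr by simp
      then have "r 0 = 0" using \<beta>0[OF m(2)] by simp
      then show False using pr a by simp
    qed
  qed
  \<comment> \<open>The diagonal equation multiplied by \<Delta>, with \<open>p\<close> and
    \<open>r\<close> eliminated; it makes \<open>d k\<close> and \<open>q k\<close>
    invertible.\<close>
  have dq: "d k * q k = \<Delta>" if "k < m" for k
  proof -
    have "d k * q k = \<Delta> * (d k * z k) - d k * \<alpha> k * u k - d k * \<beta> k * v k"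
      unfolding q_def poly_minor_poly \<Delta>_def \<alpha>_def \<beta>_def by (simp add: algebra_simps)
    also have "\<dots> = \<Delta> * (d k * z k) + p k * \<Delta> * u k + r k * \<Delta> * v k"
      unfolding pk[OF that] rk[OF that] by simp
    also have "\<dots> = \<Delta> * (p k * u k + r k * v k + d k * z k)"
      by (simp add: algebra_simps)
    finally show ?thesis
      using eq(3)[OF that that] entries(1)[OF that] by simp
  qed
  then have d0: "d k \<noteq> 0" and q0: "q k \<noteq> 0" if "k < m" for k
    using that \<open>\<Delta> \<noteq> 0\<close> by fastforce+
  have rk': "r k = - (\<beta> k / q k)" if "k < m" for k
  proof -
    have "\<Delta> * (r k * q k) = r k * \<Delta> * q k"
      by simp
    also have "\<dots> = - \<beta> k * (d k * q k)"
      unfolding rk[OF that] by simp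
    also have "\<dots> = \<Delta> * (- \<beta> k)"
      unfolding dq[OF that] by simp
    finally have "r k * q k = - \<beta> k"
      unfolding mult_left_cancel[OF \<open>\<Delta> \<noteq> 0\<close>] .
    then show ?thesis using q0[OF that] by (simp add: field_simps)
  qed
  have "(\<Sum>k<m. \<alpha> k * \<beta> k / q k) = - (\<Sum>k<m. \<alpha> k * r k)"
    by (simp add: rk' sum_negf)
  also have "\<dots> = x * (\<Sum>k<m. v k * r k) - b * (\<Sum>k<m. u k * r k)"
    by (simp add: \<alpha> sum_distrib_left sum_subtractf algebra_simps)
  \<comment> \<open>The terms in \<open>t\<close> are added so that both equations
    \<open>col\<close> apply; they cancel.\<close>
  also have "\<dots> = x * (b * t + (\<Sum>k<m. v k * r k)) - b * (x * t + (\<Sum>k<m. u k * r k))"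
    by (simp add: algebra_simps)
  also have "\<dots> = x"
    using col by simp
  finally show "poly (score m) x = 0"
    using poly_score_factor[of m x] q0 by (simp add: \<alpha>_def \<beta>_def q_def)
  have corner: "\<Sigma> $$ (Suc (Suc k), Suc (Suc l)) =
      (\<alpha> k * u l + \<beta> k * v l + (if k = l then q k else 0)) / \<Delta>" if "k < m" "l < m" for k l
  proof -
    have "d k * (\<Sigma> $$ (Suc (Suc k), Suc (Suc l)) * \<Delta>) =
        \<Delta> * (p k * u l + r k * v l + d k * \<Sigma> $$ (Suc (Suc k), Suc (Suc l)))
        - p k * \<Delta> * u l - r k * \<Delta> * v l"
      by (simp add: algebra_simps)
    also have "\<dots> = d k * (\<alpha> k * u l + \<beta> k * v l + (if k = l then q k else 0))"
      unfolding eq(3)[OF that] pk[OF that(1)] rk[OF that(1)]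
      using dq[OF that(1)] by (auto simp: algebra_simps)
    finally show ?thesis
      unfolding mult_left_cancel[OF d0[OF that(1)]] using \<open>\<Delta> \<noteq> 0\<close> by (simp add: eq_divide_eq)
  qed
  show "\<Sigma> = sol_mat m x"
  proof (rule eq_matI)
    fix i j assume "i < dim_row (sol_mat m x)" "j < dim_col (sol_mat m x)"
    then have "i < m + 2" "j < m + 2" using sol_mat_carrier[of m x] by auto
    then show "\<Sigma> $$ (i, j) = sol_mat m x $$ (i, j)"
      by (elim less_add_2_cases; simp add: entries(2-8) sol_mat_simps;
          simp add: x_def corner \<alpha>_def \<beta>_def q_def \<Delta>_def)
  qed (use sol sol_mat_carrier[of m x] in \<open>auto simp: ml_solutions_def sym_mats_def\<close>)
qed

text \<open>Roots and solutions correspond bijectively, since \<open>x\<close> is read off as the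
  entry between the small vertices.\<close>

lemma card_ml_solutions:
  assumes S: "S \<in> sym_mats (m + 2)" and nondeg: "nondegenerate m" and "m \<noteq> 1"
  shows "finite (ml_solutions (m + 2) (K2_edges m) S)"
    "card (ml_solutions (m + 2) (K2_edges m) S) = 2 * m + 1"
proof -
  have sols: "ml_solutions (m + 2) (K2_edges m) S = sol_mat m ` {x. poly (score m) x = 0}"
    using sol_mat_in_ml_solutions[OF assms] ml_solution_imp_sol_mat[OF assms] by blast
  have "inj_on (sol_mat m) {x. poly (score m) x = 0}"
    by (rule inj_onI) (metis sol_mat_simps(3))
  then show "finite (ml_solutions (m + 2) (K2_edges m) S)"
    "card (ml_solutions (m + 2) (K2_edges m) S) = 2 * m + 1"
    unfolding sols using card_roots_score[OF nondeg] by (simp_all add: card_image)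
qed

end

section \<open>Nondegeneracy is generic\<close>

lemma K2_sample_mat_poly_funs:
  "(\<lambda>S. K2_sample.a S) \<in> mat_poly_funs (m + 2)" "(\<lambda>S. K2_sample.b S) \<in> mat_poly_funs (m + 2)"
  "k < m \<Longrightarrow> (\<lambda>S. K2_sample.u S k) \<in> mat_poly_funs (m + 2)"
  "k < m \<Longrightarrow> (\<lambda>S. K2_sample.v S k) \<in> mat_poly_funs (m + 2)"
  "k < m \<Longrightarrow> (\<lambda>S. K2_sample.z S k) \<in> mat_poly_funs (m + 2)"
  unfolding K2_sample.a_def K2_sample.b_def K2_sample.u_def K2_sample.v_def K2_sample.z_def
  by (intro mat_poly_funs.entry; simp)+

lemma mat_poly_family_minor_poly:
  assumes "k < m"
  shows "mat_poly_family (m + 2) (\<lambda>S. K2_sample.minor_poly S k)"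
  unfolding K2_sample.minor_poly_def
  by (intro mat_poly_family_intros mat_poly_funs_intros K2_sample_mat_poly_funs assms)

lemma mat_poly_family_score: "mat_poly_family (m + 2) (\<lambda>S. K2_sample.score S m)"
  unfolding K2_sample.score_def K2_sample.cof0_poly_def K2_sample.cof1_poly_def
  by (intro mat_poly_family_intros mat_poly_funs_intros K2_sample_mat_poly_funs
      mat_poly_family_minor_poly) auto

text \<open>Unit variances, with vertex 1 alone correlated with the large part. Then minors and
  score depend on \<open>w\<close> only through the squares \<open>(w k)\<^sup>2\<close>.\<close>

definition wit_mat :: "nat \<Rightarrow> (nat \<Rightarrow> complex) \<Rightarrow> complex mat" where
  "wit_mat m w = mat (m + 2) (m + 2) (\<lambda>(i, j).
     if i = j then 1 else if min i j = 1 then w (max i j - 2) else 0)"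

lemma wit_mat_sym: "wit_mat m w \<in> sym_mats (m + 2)"
  by (auto simp: sym_mats_def wit_mat_def min.commute max.commute intro!: eq_matI)

lemma wit_mat_simps:
  "K2_sample.a (wit_mat m w) = 1" "K2_sample.b (wit_mat m w) = 1"
  "k < m \<Longrightarrow> K2_sample.u (wit_mat m w) k = 0"
  "k < m \<Longrightarrow> K2_sample.v (wit_mat m w) k = w k"
  "k < m \<Longrightarrow> K2_sample.z (wit_mat m w) k = 1"
  by (simp_all add: wit_mat_def K2_sample.a_def K2_sample.b_def K2_sample.u_def
      K2_sample.v_def K2_sample.z_def)

lemma wit_mat_minor_poly:
  "k < m \<Longrightarrow> K2_sample.minor_poly (wit_mat m w) k = [: 1 - (w k)\<^sup>2, 0, - 1 :]"
  by (simp add: K2_sample.minor_poly_def wit_mat_simps)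

text \<open>Taking the squares \<open>(w k)\<^sup>2\<close> to be the \<open>m\<close>-th roots of unity makes the product of the minors
  \<open>P t = t ^ m - 1\<close> with \<open>t = 1 - x\<^sup>2\<close>, and the sum over \<open>k\<close> a combination of \<open>P t\<close> and \<open>t * P' t\<close>, so
  that the score becomes explicit.\<close>

lemma wit_mat_score:
  assumes "m > 0"
  obtains w where
    "K2_sample.score (wit_mat m w) m = [:0, 1:] * ([:1, 0, -1:] ^ m + [:of_nat m - 1:])"
proof -
  define P :: "complex poly" where "P = monom 1 m - 1"
  have deg: "degree P = m"
    using assms unfolding P_def diff_conv_add_uminus
    by (subst degree_add_eq_left) (simp_all add: degree_monom_eq)
  have "lead_coeff P = 1"
    using assms unfolding deg by (simp add: P_def coeff_1)
  then obtain c where c: "(\<Prod>k<m. [:- c k, 1:]) = P"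
    using complex_poly_decompose'[of P] by (auto simp: deg)
  define w where "w k = csqrt (c k)" for k
  have w: "(w k)\<^sup>2 = c k" for k by (simp add: w_def)
  show ?thesis
  proof (rule that[of w], rule poly_eq_poly_eq_iff[THEN iffD1], rule ext)
    fix x :: complex
    define t where "t = 1 - x\<^sup>2"
    have q: "poly (K2_sample.minor_poly (wit_mat m w) k) x = t - c k" if "k < m" for k
      using that w[of k] by (simp add: wit_mat_minor_poly t_def power2_eq_square)
    have prod: "(\<Prod>k<m. t - c k) = t ^ m - 1"
      using arg_cong[OF c, of "\<lambda>p. poly p t"]
      by (simp add: poly_prod P_def poly_monom add.commute)
    \<comment> \<open>The derivative of the factorised \<open>P\<close>, evaluated at
      \<open>t\<close>.\<close>
    have deriv: "(\<Sum>k<m. \<Prod>j\<in>{..<m} - {k}. t - c j) = of_nat m * t ^ (m - 1)"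
      using arg_cong[OF c, of "\<lambda>p. poly (pderiv p) t"]
      by (simp add: pderiv_prod poly_sum poly_prod P_def poly_monom pderiv_diff pderiv_monom
          pderiv_pCons add.commute)
    \<comment> \<open>Write \<open>c k\<close> as \<open>t - (t - c k)\<close>; the second part
      completes the product to \<open>P t\<close>.\<close>
    have summand: "c k * (\<Prod>j\<in>{..<m} - {k}. t - c j) = t * (\<Prod>j\<in>{..<m} - {k}. t - c j) - (t ^ m - 1)"
      if "k < m" for k
      unfolding prod[symmetric] using that by (subst prod.remove[of _ k]) (auto simp: algebra_simps)
    have tm: "t * t ^ (m - 1) = t ^ m"
      using assms by (cases m) auto
    have "poly (K2_sample.score (wit_mat m w) m) x =
        x * (\<Prod>k<m. t - c k) + (\<Sum>k<m. x * (c k * (\<Prod>j\<in>{..<m} - {k}. t - c j)))"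
      using w by (simp add: K2_sample.score_def poly_sum poly_prod q K2_sample.cof0_poly_def
          K2_sample.cof1_poly_def wit_mat_simps sum_negf power2_eq_square mult_ac)
    also have "\<dots> = x * (t ^ m - 1) + x * (t * (of_nat m * t ^ (m - 1)) - of_nat m * (t ^ m - 1))"
      unfolding prod deriv[symmetric]
      by (simp add: summand sum_distrib_left[symmetric] sum_subtractf)
    also have "\<dots> = x * (t ^ m + of_nat m - 1)"
      using tm by (simp add: algebra_simps)
    also have "\<dots> = poly ([:0, 1:] * ([:1, 0, -1:] ^ m + [:of_nat m - 1:])) x"
      by (simp add: t_def power2_eq_square algebra_simps)
    finally show "poly (K2_sample.score (wit_mat m w) m) x =
        poly ([:0, 1:] * ([:1, 0, -1:] ^ m + [:of_nat m - 1:])) x" .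
  qed
qed

text \<open>For positive \<open>m\<close> the derivative at 0 is \<open>m\<close>. At another root
  it is \<open>-2 * m * x\<^sup>2 * (1 - x\<^sup>2) ^ (m - 1)\<close>; if this vanished, then
  \<open>m \<noteq> 1\<close> and \<open>1 - x\<^sup>2 = 0\<close>, and the root equation would say
  \<open>m = 1\<close>.\<close>

lemma wit_mat_score_squarefree:
  obtains w where "\<And>x. poly (K2_sample.score (wit_mat m w) m) x = 0 \<Longrightarrow>
    poly (pderiv (K2_sample.score (wit_mat m w) m)) x \<noteq> 0"
proof (cases "m = 0")
  case True
  show ?thesis
    by (rule that[of "\<lambda>_. 0"]) (simp add: True K2_sample.score_def pderiv_pCons)
next
  case False
  then obtain w where w:
    "K2_sample.score (wit_mat m w) m = [:0, 1:] * ([:1, 0, -1:] ^ m + [:of_nat m - 1:])"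
    using wit_mat_score by blast
  show ?thesis
  proof (rule that[of w])
    fix x assume root: "poly (K2_sample.score (wit_mat m w) m) x = 0"
    have deriv: "poly (pderiv (K2_sample.score (wit_mat m w) m)) x =
        ((1 - x\<^sup>2) ^ m + of_nat m - 1) - 2 * of_nat m * x\<^sup>2 * (1 - x\<^sup>2) ^ (m - 1)"
      unfolding w
      by (simp add: pderiv_mult pderiv_add pderiv_power pderiv_pCons power2_eq_square algebra_simps)
    have "x * ((1 - x\<^sup>2) ^ m + of_nat m - 1) = 0"
      using root unfolding w by (simp add: power2_eq_square algebra_simps)
    then consider "x = 0" | "x \<noteq> 0" "(1 - x\<^sup>2) ^ m + of_nat m - 1 = 0" by auto
    then show "poly (pderiv (K2_sample.score (wit_mat m w) m)) x \<noteq> 0"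
    proof cases
      case 1
      then show ?thesis using False unfolding deriv by simp
    next
      case 2
      have "(1 - x\<^sup>2) ^ (m - 1) \<noteq> 0"
      proof
        assume "(1 - x\<^sup>2) ^ (m - 1) = 0"
        then have "m \<noteq> 1" "1 - x\<^sup>2 = 0" by (auto simp: power_eq_0_iff)
        then have "of_nat m = (of_nat 1 :: complex)" using 2(2) False by (simp add: power_0_left)
        then show False using \<open>m \<noteq> 1\<close> by (simp only: of_nat_eq_iff)
      qed
      then show ?thesis using 2 False unfolding deriv by simp
    qed
  qed
qed

text \<open>Each condition gets its own witness; generic properties are closed under finite
  conjunction, so no single sample has to meet them all.\<close>

lemma generic_sym_nondegenerate:
  "generic_sym (m + 2) (\<lambda>S. K2_sample.nondegenerate S m)"
proof -
  note intros = mat_poly_funs_intros K2_sample_mat_poly_funs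
  have wit: "generic_sym (m + 2) (\<lambda>S. f S \<noteq> 0)"
    if "f \<in> mat_poly_funs (m + 2)" "f (wit_mat m w) \<noteq> 0" for f w
    using generic_symI[OF that(1) wit_mat_sym that(2)] .
  have a: "generic_sym (m + 2) (\<lambda>S. K2_sample.a S \<noteq> 0)"
    by (rule wit[of _ "\<lambda>_. 0"], intro intros) (simp add: wit_mat_simps)
  have b: "generic_sym (m + 2) (\<lambda>S. K2_sample.b S \<noteq> 0)"
    by (rule wit[of _ "\<lambda>_. 0"], intro intros) (simp add: wit_mat_simps)
  have z: "generic_sym (m + 2) (\<lambda>S. K2_sample.z S k \<noteq> 0)" if "k < m" for k
    by (rule wit[of _ "\<lambda>_. 0"], intro intros that) (simp add: wit_mat_simps that)
  have av: "generic_sym (m + 2) (\<lambda>S. K2_sample.a S * (K2_sample.v S k)\<^sup>2 - K2_sample.b S * (K2_sample.u S k)\<^sup>2 \<noteq> 0)"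
    if "k < m" for k
    \<comment> \<open>Here \<open>w = 0\<close> would make both sides vanish, so
      \<open>w = 1\<close> is taken.\<close>
    by (rule wit[of _ "\<lambda>_. 1"], intro intros that) (simp add: wit_mat_simps that)
  have zb: "generic_sym (m + 2) (\<lambda>S. K2_sample.z S k * K2_sample.b S - (K2_sample.v S k)\<^sup>2 \<noteq> 0)" if "k < m" for k
    by (rule wit[of _ "\<lambda>_. 0"], intro intros that) (simp add: wit_mat_simps that)
  have za: "generic_sym (m + 2) (\<lambda>S. K2_sample.z S k * K2_sample.a S - (K2_sample.u S k)\<^sup>2 \<noteq> 0)" if "k < m" for k
    by (rule wit[of _ "\<lambda>_. 0"], intro intros that) (simp add: wit_mat_simps that)
  have minors: "generic_sym (m + 2) (\<lambda>S. i \<noteq> j \<longrightarrow>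
      resultant_sub 2 2 (K2_sample.minor_poly S i) (K2_sample.minor_poly S j) \<noteq> 0)"
    if ij: "i < m" "j < m" for i j
  proof (cases "i = j")
    case True
    \<comment> \<open>The implication is vacuous, but genericity still asks for a nonempty open set;
      that of \<open>a\<close> is borrowed.\<close>
    show ?thesis by (rule generic_sym_mono[OF a]) (simp add: True)
  next
    case False
    \<comment> \<open>Taking \<open>w k = k\<close> makes the squares distinct, so the minors
      \<open>1 - k\<^sup>2 - x\<^sup>2\<close> have no common root.\<close>
    let ?q = "K2_sample.minor_poly (wit_mat m of_nat)"
    have "resultant_sub 2 2 (?q i) (?q j) \<noteq> 0"
    proof
      assume "resultant_sub 2 2 (?q i) (?q j) = 0"
      then obtain x where "poly (?q i) x = 0" "poly (?q j) x = 0"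
        using ij resultant_sub_eq_0_iff[of "?q i" 2 "?q j" 2] by (auto simp: wit_mat_minor_poly)
      then have eqs: "1 - (of_nat i)\<^sup>2 = x * x" "1 - (of_nat j)\<^sup>2 = x * x"
        using ij by (simp_all add: wit_mat_minor_poly)
      have "of_nat (i\<^sup>2) = 1 - (1 - (of_nat i)\<^sup>2 :: complex)" by simp
      also have "\<dots> = 1 - (1 - (of_nat j)\<^sup>2)" by (simp only: eqs)
      finally have "of_nat (i\<^sup>2) = (of_nat (j\<^sup>2) :: complex)" by simp
      then show False using False by (simp only: of_nat_eq_iff) simp
    qed
    then have "generic_sym (m + 2) (\<lambda>S.
        resultant_sub 2 2 (K2_sample.minor_poly S i) (K2_sample.minor_poly S j) \<noteq> 0)"
      using ij
      by (intro generic_symI[OF _ wit_mat_sym] mat_poly_funs_resultant_sub mat_poly_family_minor_poly)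
    then show ?thesis by (rule generic_sym_mono) simp
  qed
  have score: "generic_sym (m + 2) (\<lambda>S.
      resultant_sub (2 * m + 1) (2 * m) (K2_sample.score S m) (pderiv (K2_sample.score S m)) \<noteq> 0)"
  proof -
    obtain w where w: "\<And>x. poly (K2_sample.score (wit_mat m w) m) x = 0 \<Longrightarrow>
        poly (pderiv (K2_sample.score (wit_mat m w) m)) x \<noteq> 0"
      using wit_mat_score_squarefree by blast
    have deg: "degree (K2_sample.score (wit_mat m w) m) = 2 * m + 1"
      by (rule K2_sample.degree_score) (simp add: wit_mat_simps)
    then have "K2_sample.score (wit_mat m w) m \<noteq> 0" by auto
    then have "resultant_sub (2 * m + 1) (2 * m) (K2_sample.score (wit_mat m w) m)
        (pderiv (K2_sample.score (wit_mat m w) m)) \<noteq> 0"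
      using w by (subst resultant_sub_eq_0_iff) (auto simp: deg degree_pderiv)
    then show ?thesis
      by (intro generic_symI[OF _ wit_mat_sym] mat_poly_funs_resultant_sub mat_poly_family_score
          mat_poly_family_pderiv)
  qed
  have "generic_sym (m + 2) (\<lambda>S. K2_sample.a S \<noteq> 0 \<and> K2_sample.b S \<noteq> 0 \<and>
     (\<forall>k<m. K2_sample.z S k \<noteq> 0 \<and>
        K2_sample.a S * (K2_sample.v S k)\<^sup>2 - K2_sample.b S * (K2_sample.u S k)\<^sup>2 \<noteq> 0 \<and>
        K2_sample.z S k * K2_sample.b S - (K2_sample.v S k)\<^sup>2 \<noteq> 0 \<and>
        K2_sample.z S k * K2_sample.a S - (K2_sample.u S k)\<^sup>2 \<noteq> 0) \<and>
     (\<forall>i<m. \<forall>j<m. i \<noteq> j \<longrightarrow>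
        resultant_sub 2 2 (K2_sample.minor_poly S i) (K2_sample.minor_poly S j) \<noteq> 0) \<and>
     resultant_sub (2 * m + 1) (2 * m) (K2_sample.score S m) (pderiv (K2_sample.score S m)) \<noteq> 0)"
    by (intro generic_sym_conjI generic_sym_all_less a b z av zb za minors score)
  then show ?thesis
    by (rule generic_sym_mono) (auto simp: K2_sample.nondegenerate_def)
qed

theorem theorem4p3:
  fixes m :: nat
  assumes "m \<noteq> 1"
  shows "has_ML_degree (m + 2) (K2_edges m) (2 * m + 1)"
  unfolding has_ML_degree_def
  using generic_sym_nondegenerate
  by (rule generic_sym_mono) (use K2_sample.card_ml_solutions assms in blast)

end
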